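(* For every initial velocity ${\bf v}_0\in\mathbb{R}^2$ of the disk, the algorithm given by the ideal iterative rule (defined in the context) terminates after a finite number of steps; that is, there exists an integer $N\ge 0$ such that ${\bf v}_N\in\mathcal{Z}_0$.
   Context: A rigid disk is simultaneously in contact with two walls forming a corner of angle $2\alpha\in(0,\pi)$; put $k=\tan\alpha>0$. The linear velocity of the disk is a pair $(\dot x,\dot y)\in\mathbb{R}^2$. The plane of velocities is partitioned into four zones: $\mathcal{Z}_0=\{k\dot x+\dot y\le 0,\ k\dot x-\dot y\le 0\}$ (exit velocities), $\mathcal{Z}_1=\{k\dot x+\dot y\le 0,\ k\dot x-\dot y>0\}$ (impact with the first wall only), $\mathcal{Z}_2=\{k\dot x+\dot y>0,\ k\dot x-\dot y\le 0\}$ (impact with the second wall only), $\mathcal{Z}_{12}=\{k\dot x+\dot y>0,\ k\dot x-\dot y>0\}$ (multiple impact). Ideal iterative rule. Given ${\bf v}_n=(\dot x_n,\dot y_n)$, define ${\bf v}_{n+1}=(\dot x_{n+1},\dot y_{n+1})$ by: - if ${\bf v}_n\in\mathcal{Z}_0$: ${\bf v}_{n+1}={\bf v}_n$; - if ${\bf v}_n\in\mathcal{Z}_1$: $\dot x_{n+1}=\frac{1-k^2}{1+k^2}\dot x_n+\frac{2k}{1+k^2}\dot y_n$, $\ \dot y_{n+1}=\frac{2k}{1+k^2}\dot x_n-\frac{1-k^2}{1+k^2}\dot y_n$; - if ${\bf v}_n\in\mathcal{Z}_2$: $\dot x_{n+1}=\frac{1-k^2}{1+k^2}\dot x_n-\frac{2k}{1+k^2}\dot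 y_n$, $\ \dot y_{n+1}=-\frac{2k}{1+k^2}\dot x_n-\frac{1-k^2}{1+k^2}\dot y_n$; - if ${\bf v}_n\in\mathcal{Z}_{12}$: $\dot x_{n+1}=\frac{-k^4\dot x_n^2+(1-2k^2)\dot y_n^2}{k^4\dot x_n^2+\dot y_n^2}\,\dot x_n$, $\ \dot y_{n+1}=\frac{k^2(k^2-2)\dot x_n^2-\dot y_n^2}{k^4\dot x_n^2+\dot y_n^2}\,\dot y_n$. The algorithm terminates when the current velocity ${\bf v}_n$ belongs to $\mathcal{Z}_0$ (from then on the sequence is constant and the disk exits from the corner). *)

theory Defs
  imports Complex_Main
begin

text \<open>The parameter \<open>k\<close> is \<open>tan \<alpha>\<close>, where \<open>2 \<alpha>\<close> is the angle of the corner.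
  A velocity is a pair \<open>(x, y)\<close> of its two components.\<close>

definition zone_exit :: "real \<Rightarrow> (real \<times> real) set" where
  "zone_exit k = {(x, y). k * x + y \<le> 0 \<and> k * x - y \<le> 0}"

definition zone_first :: "real \<Rightarrow> (real \<times> real) set" where
  "zone_first k = {(x, y). k * x + y \<le> 0 \<and> k * x - y > 0}"

definition zone_second :: "real \<Rightarrow> (real \<times> real) set" where
  "zone_second k = {(x, y). k * x + y > 0 \<and> k * x - y \<le> 0}"

definition zone_multiple :: "real \<Rightarrow> (real \<times> real) set" where
  "zone_multiple k = {(x, y). k * x + y > 0 \<and> k * x - y > 0}"

lemma zones_cover:
  "zone_exit k \<union> zone_first k \<union> zone_second k \<union> zone_multiple k = UNIV"
  by (auto simp: zone_exit_def zone_first_def zone_second_def zone_multiple_def)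

lemma zones_disjoint:
  "zone_exit k \<inter> zone_first k = {}" "zone_exit k \<inter> zone_second k = {}"
  "zone_exit k \<inter> zone_multiple k = {}" "zone_first k \<inter> zone_second k = {}"
  "zone_first k \<inter> zone_multiple k = {}" "zone_second k \<inter> zone_multiple k = {}"
  by (auto simp: zone_exit_def zone_first_def zone_second_def zone_multiple_def)

definition first_impact :: "real \<Rightarrow> real \<times> real \<Rightarrow> real \<times> real" where
  "first_impact k = (\<lambda>(x, y).
     ((1 - k^2) / (1 + k^2) * x + 2 * k / (1 + k^2) * y,
      2 * k / (1 + k^2) * x - (1 - k^2) / (1 + k^2) * y))"

definition second_impact :: "real \<Rightarrow> real \<times> real \<Rightarrow> real \<times> real" where
  "second_impact k = (\<lambda>(x, y).
     ((1 - k^2) / (1 + k^2) * x - 2 * k / (1 + k^2) * y,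
      - (2 * k / (1 + k^2)) * x - (1 - k^2) / (1 + k^2) * y))"

text \<open>For \<open>k > 0\<close> the denominator below is positive on \<^term>\<open>zone_multiple k\<close>, since \<open>x > 0\<close> there.\<close>

definition multiple_impact :: "real \<Rightarrow> real \<times> real \<Rightarrow> real \<times> real" where
  "multiple_impact k = (\<lambda>(x, y).
     ((- (k^4) * x^2 + (1 - 2 * k^2) * y^2) / (k^4 * x^2 + y^2) * x,
      (k^2 * (k^2 - 2) * x^2 - y^2) / (k^4 * x^2 + y^2) * y))"

text \<open>By \<open>zones_cover\<close>, the last branch is the case \<open>v \<in> zone_multiple k\<close>.\<close>

definition ideal_step :: "real \<Rightarrow> real \<times> real \<Rightarrow> real \<times> real" where
  "ideal_step k v =
     (if v \<in> zone_exit k then v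
      else if v \<in> zone_first k then first_impact k v
      else if v \<in> zone_second k then second_impact k v
      else multiple_impact k v)"

end

theory Submission
  imports Defs
begin

text \<open>
  The numbers \<open>p = k x - y\<close> and \<open>q = k x + y\<close> are, up to a common positive factor, the speeds at which
  the disk approaches the first and the second wall, and the zones are just the four sign patterns of
  \<open>(p, q)\<close>. With \<open>c = (1 - k\<^sup>2) / (1 + k\<^sup>2) = cos (2 \<alpha>)\<close>, the impact with the first wall is the
  reflection \<open>(p, q) \<mapsto> (- p, q + 2 c p)\<close>, and the impact with the second wall is the same with the
  walls exchanged.

  A multiple impact never leads to another multiple impact: the wall that the disk was
  approaching faster is not approached afterwards
  (\<open>multiple_impact_not_multiple\<close>). A single impact makes the approach speed of its own wall
  negative, so a motion that never exits is, from the second velocity on, an alternating sequence of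
  single impacts. Its successive approach speeds \<open>a\<^sub>n > 0\<close> satisfy
  \<open>a\<^sub>n\<^sub>+\<^sub>2 = 2 c a\<^sub>n\<^sub>+\<^sub>1 - a\<^sub>n\<close>. The solutions of this recurrence with \<open>\<bar>c\<bar> < 1\<close> are the sinusoids
  of frequency \<open>2 \<alpha>\<close>, so they cannot stay positive (\<open>oscillating_recurrence_nonpos\<close>).
\<close>

section \<open>An oscillating linear recurrence\<close>

text \<open>
  If all terms were positive, the ratios \<open>r\<close> of consecutive terms would follow the map
  \<open>r \<mapsto> 2 c - 1 / r\<close>. As \<open>r\<^sup>2 - 2 c r + 1\<close> has negative discriminant, this map lowers every
  positive ratio, and by a fixed amount once the ratio lies below \<open>2 c\<close>.
\<close>

lemma oscillating_recurrence_nonpos: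
  fixes a :: "nat \<Rightarrow> real"
  assumes c: "\<bar>c\<bar> < 1"
    and rec: "\<And>n. a (Suc (Suc n)) = 2 * c * a (Suc n) - a n"
  shows "\<exists>n. a n \<le> 0"
proof (rule ccontr)
  assume "\<not> ?thesis"
  then have pos: "a n > 0" for n
    by (simp add: not_le)
  define r where "r n = a (Suc n) / a n" for n
  have r_pos: "r n > 0" for n
    using pos by (simp add: r_def)
  have r_Suc: "r (Suc n) = 2 * c - 1 / r n" for n
    using pos[of n] pos[of "Suc n"] by (simp add: r_def rec field_simps)
  have r_less: "r (Suc n) < 2 * c" for n
    using r_Suc[of n] r_pos[of n] by simp
  have c_pos: "c > 0"
    using r_less[of 0] r_pos[of 1] by simp
  define d where "d = (1 - c\<^sup>2) / (2 * c)"
  have c_sq: "c\<^sup>2 < 1"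
    using c by (simp add: abs_square_less_1)
  then have d_pos: "d > 0"
    using c_pos by (simp add: d_def)
  have drop: "r (Suc (Suc n)) \<le> r (Suc n) - d" for n
  proof -
    let ?r = "r (Suc n)"
    have "d \<le> (1 - c\<^sup>2) / ?r"
      unfolding d_def using c_sq c_pos r_pos[of "Suc n"] r_less[of n]
      by (intro divide_left_mono) auto
    also have "\<dots> \<le> ((?r - c)\<^sup>2 + (1 - c\<^sup>2)) / ?r"
      using r_pos[of "Suc n"] by (intro divide_right_mono) auto
    also have "\<dots> = ?r - (2 * c - 1 / ?r)"
      using r_pos[of "Suc n"] by (simp add: field_simps power2_eq_square)
    finally show ?thesis
      by (simp add: r_Suc[of "Suc n"])
  qed
  have bound: "r (Suc n) \<le> r 1 - real n * d" for n
  proof (induction n)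
    case (Suc n)
    then show ?case
      using drop[of n] by (simp add: algebra_simps)
  qed simp
  obtain n where "r 1 < real n * d"
    using reals_Archimedean3[OF d_pos] by blast
  then show False
    using bound[of n] r_pos[of "Suc n"] by simp
qed

section \<open>Approach speeds of the two walls\<close>

definition approach_first :: "real \<Rightarrow> real \<times> real \<Rightarrow> real" where
  "approach_first k v = k * fst v - snd v"

definition approach_second :: "real \<Rightarrow> real \<times> real \<Rightarrow> real" where
  "approach_second k v = k * fst v + snd v"

lemma mem_zone_iff:
  "v \<in> zone_exit k \<longleftrightarrow> approach_first k v \<le> 0 \<and> approach_second k v \<le> 0"
  "v \<in> zone_first k \<longleftrightarrow> approach_first k v > 0 \<and> approach_second k v \<le> 0"
  "v \<in> zone_second k \<longleftrightarrow> approach_first k v \<le> 0 \<and> approach_second k v > 0"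
  "v \<in> zone_multiple k \<longleftrightarrow> approach_first k v > 0 \<and> approach_second k v > 0"
  by (cases v; auto simp: approach_first_def approach_second_def zone_exit_def zone_first_def
      zone_second_def zone_multiple_def)+

abbreviation cos_corner :: "real \<Rightarrow> real" where
  "cos_corner k \<equiv> (1 - k\<^sup>2) / (1 + k\<^sup>2)"

lemma one_plus_square_pos: "1 + k\<^sup>2 > (0::real)"
  by (simp add: add_pos_nonneg)

lemma abs_cos_corner_less_one:
  assumes "k > 0"
  shows "\<bar>cos_corner k\<bar> < 1"
proof -
  have "0 < k\<^sup>2"
    using assms by simp
  then have "- 1 < cos_corner k" "cos_corner k < 1"
    using one_plus_square_pos[of k] by (simp_all add: less_divide_eq divide_less_eq)
  then show ?thesis
    by (simp only: abs_less_iff) simp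
qed

lemma approach_after_first_impact:
  "approach_first k (first_impact k v) = - approach_first k v"
  "approach_second k (first_impact k v)
    = approach_second k v + 2 * cos_corner k * approach_first k v"
  using one_plus_square_pos[of k]
  by (cases v; simp add: approach_first_def approach_second_def first_impact_def divide_simps;
      simp add: algebra_simps power2_eq_square)+

lemma approach_after_second_impact:
  "approach_second k (second_impact k v) = - approach_second k v"
  "approach_first k (second_impact k v)
    = approach_first k v + 2 * cos_corner k * approach_second k v"
  using one_plus_square_pos[of k]
  by (cases v; simp add: approach_first_def approach_second_def second_impact_def divide_simps;
      simp add: algebra_simps power2_eq_square)+

section \<open>Multiple impacts do not repeat\<close>

text \<open>
  For \<open>y \<ge> 0\<close> the second wall is approached at least as fast as the first. Up to a positive factor, its
  new approach speed is the cubic form estimated here, whose two terms of the wrong sign are absorbed by means of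
  \<open>y < k x\<close>. The case \<open>y \<le> 0\<close> follows by the mirror symmetry \<open>y \<mapsto> - y\<close>, which exchanges the
  walls.
\<close>

lemma multiple_impact_approach_second_nonpos:
  assumes k: "k > 0" and y: "0 \<le> y" "y < k * x"
  shows "approach_second k (multiple_impact k (x, y)) \<le> 0"
proof -
  have x: "x > 0"
    using k y by (metis le_less_trans zero_less_mult_pos)
  have "k * x * y * y \<le> k * x * y * (k * x)" "k^4 * x^2 * y \<le> k^4 * x^2 * (k * x)"
    using k x y by (intro mult_left_mono; simp)+
  moreover have "0 \<le> y^3" "0 \<le> k^3 * x * y^2" "0 \<le> k^2 * x^2 * y"
    using k x y by simp_all
  ultimately have "k * ((- (k^4) * x^2 + (1 - 2 * k^2) * y^2) * x)
      + (k^2 * (k^2 - 2) * x^2 - y^2) * y \<le> 0" (is "?N \<le> 0")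
    by (simp add: algebra_simps power2_eq_square power3_eq_cube power4_eq_xxxx)
  moreover have "approach_second k (multiple_impact k (x, y)) = ?N / (k^4 * x^2 + y^2)"
    by (simp add: approach_second_def multiple_impact_def add_divide_distrib)
  ultimately show ?thesis
    by (simp add: divide_nonpos_nonneg)
qed

lemma approach_first_mirror:
  "approach_first k (multiple_impact k (x, y)) = approach_second k (multiple_impact k (x, - y))"
  by (simp add: approach_first_def approach_second_def multiple_impact_def)

lemma multiple_impact_not_multiple:
  assumes k: "k > 0" and v: "v \<in> zone_multiple k"
  shows "multiple_impact k v \<notin> zone_multiple k"
proof -
  obtain x y where xy: "v = (x, y)"
    by (cases v)
  have "y < k * x" "- y < k * x"
    using v by (auto simp: xy zone_multiple_def)
  then show ?thesis
    using multiple_impact_approach_second_nonpos[OF k, of y x]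
      multiple_impact_approach_second_nonpos[OF k, of "- y" x]
    by (cases "y \<ge> 0") (auto simp: xy mem_zone_iff approach_first_mirror)
qed

section \<open>Termination\<close>

text \<open>
  Single impacts also avoid multiple ones, since they make one approach speed negative.
\<close>

lemma ideal_step_not_multiple:
  assumes "k > 0"
  shows "ideal_step k v \<notin> zone_multiple k"
  using multiple_impact_not_multiple[OF assms, of v]
  by (auto simp: ideal_step_def mem_zone_iff approach_after_first_impact
      approach_after_second_impact not_le)

text \<open>
  Outside the multiple zone, the larger of the two approach speeds is that of the wall about to be
  hit, as long as the disk has not exited. Taking the maximum thus describes the alternation
  of the walls by one sequence of numbers.
\<close>

definition impact_speed :: "real \<Rightarrow> real \<times> real \<Rightarrow> real" where
  "impact_speed k v = max (approach_first k v) (approach_second k v)"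

lemma impact_speed_recurrence:
  assumes k: "k > 0"
    and v: "v \<notin> zone_exit k" "v \<notin> zone_multiple k"
    and w: "w = ideal_step k v" "w \<notin> zone_exit k"
    and u: "u = ideal_step k w" "u \<notin> zone_exit k"
  shows "impact_speed k u = 2 * cos_corner k * impact_speed k w - impact_speed k v"
proof -
  consider "v \<in> zone_first k" | "v \<in> zone_second k"
    using v zones_cover[of k] by blast
  then show ?thesis
  proof cases
    case 1
    then have w': "w = first_impact k v"
      using v w by (simp add: ideal_step_def)
    then have "w \<in> zone_second k"
      using 1 w by (auto simp: mem_zone_iff approach_after_first_impact)
    moreover from this have u': "u = second_impact k w"
      using u by (auto simp: ideal_step_def mem_zone_iff)
    ultimately have "u \<in> zone_first k"
      using u by (auto simp: mem_zone_iff approach_after_second_impact)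
    with 1 \<open>w \<in> zone_second k\<close> have
      "impact_speed k u = approach_first k u" "impact_speed k w = approach_second k w"
      "impact_speed k v = approach_first k v"
      by (auto simp: impact_speed_def mem_zone_iff)
    moreover have "approach_first k w = - approach_first k v"
      by (simp add: w' approach_after_first_impact)
    ultimately show ?thesis
      by (simp add: u' approach_after_second_impact)
  next
    case 2
    then have w': "w = second_impact k v"
      using v w by (auto simp: ideal_step_def mem_zone_iff)
    then have "w \<in> zone_first k"
      using 2 w by (auto simp: mem_zone_iff approach_after_second_impact)
    moreover from this have u': "u = first_impact k w"
      using u by (auto simp: ideal_step_def)
    ultimately have "u \<in> zone_second k"
      using u by (auto simp: mem_zone_iff approach_after_first_impact)
    with 2 \<open>w \<in> zone_first k\<close> have
      "impact_speed k u = approach_second k u" "impact_speed k w = approach_first k w"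
      "impact_speed k v = approach_second k v"
      by (auto simp: impact_speed_def mem_zone_iff)
    moreover have "approach_second k w = - approach_second k v"
      by (simp add: w' approach_after_second_impact)
    ultimately show ?thesis
      by (simp add: u' approach_after_first_impact)
  qed
qed

theorem corollary3p1:
  fixes \<alpha> k :: real and v :: "nat \<Rightarrow> real \<times> real"
  assumes "0 < 2 * \<alpha>" and "2 * \<alpha> < pi" and "k = tan \<alpha>"
    and "\<And>n. v (Suc n) = ideal_step k (v n)"
  shows "\<exists>N. v N \<in> zone_exit k"
proof (rule ccontr)
  assume "\<not> ?thesis"
  then have no_exit: "v n \<notin> zone_exit k" for n
    by simp
  have k: "k > 0"
    using assms(1-3) by (simp add: tan_gt_zero)
  \<comment> \<open>The initial velocity may cause a multiple impact, so the recurrence starts one step later.\<close>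
  define a where "a n = impact_speed k (v (Suc n))" for n
  have no_multiple: "v (Suc n) \<notin> zone_multiple k" for n
    unfolding assms(4) by (rule ideal_step_not_multiple[OF k])
  have "a (Suc (Suc n)) = 2 * cos_corner k * a (Suc n) - a n" for n
    unfolding a_def
    by (rule impact_speed_recurrence[OF k no_exit no_multiple assms(4) no_exit assms(4) no_exit])
  then obtain n where "a n \<le> 0"
    using oscillating_recurrence_nonpos[OF abs_cos_corner_less_one[OF k], of a] by blast
  then show False
    using no_exit[of "Suc n"] by (auto simp: a_def impact_speed_def mem_zone_iff)
qed

end
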